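(* Let $\mathbb{F}$ be a field. Every indecomposable thin persistence module $M:(\mathbb{R},\leq)^2\to\mathbf{vect}_{\mathbb{F}}$ is isomorphic to a polytope module, i.e. to $\mathbb{F}I$ for some interval $I$ of $(\mathbb{R},\leq)^2$.
   Context: $\mathbf{vect}_{\mathbb{F}}$ is the category of finite-dimensional $\mathbb{F}$-vector spaces. $(\mathbb{R},\leq)^2$ is $\mathbb{R}^2$ with the product order, viewed as a category; a persistence module over it is a functor $M$ to vector spaces, with values $Mi$ and structure maps $M(i\leq j)$. $M$ is thin if $\dim(Mi)\in\{0,1\}$ for all $i$. $M$ is decomposable if there exist nonzero subrepresentations $N,N'$ of $M$ such that $Mi\cong Ni\oplus N'i$ for all $i$ (for thin $M$ this is equivalent to $M=N\oplus N'$ with $N,N'$ nonzero); $M$ is indecomposable if it is not decomposable. A subset $I$ of a poset is convex if $i,k\in I$ and $i\leq j\leq k$ imply $j\in I$. It is connected if for all $a,b\in I$ there exist $x_0=a,x_1,\dots,x_n=b$ in $I$ such that $x_i$ and $x_{i+1}$ are comparable for each $i$. An interval is a connected and convex subset. (With these definitions the zero module counts as indecomposable, the empty set counts as an interval, and the zero module is the polytope module over the empty set.) For an interval $I$ of $(\mathbb{R},\leq)^2$, the polytope module $\mathbb{F}I$ has $(\mathbb{F}I)i=\mathbb{F}$ if $i\in I$ and $0$ otherwise, with structure map $(\mathbb{F}I)(i\leq j)=\mathrm{id}_{\mathbb{F}}$ if $i\leq j$ are both in $I$, and $0$ otherwise. *)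

theory Defs
  imports "HOL-Analysis.Product_Vector" "HOL-Library.Product_Order"
begin

text \<open>
  Vector spaces over the field \<open>'f\<close> are rendered as subspaces of an ambient space
  \<open>(scale, 'v)\<close>. A family of vector spaces indexed by a poset embeds in its direct sum, so
  placing all values of one functor in a common ambient space (of arbitrary type \<open>'v\<close> and
  arbitrary, possibly infinite, dimension) is no restriction.
\<close>

definition linear_between ::
  "('f::field \<Rightarrow> 'v::ab_group_add \<Rightarrow> 'v) \<Rightarrow> ('f \<Rightarrow> 'w::ab_group_add \<Rightarrow> 'w)
    \<Rightarrow> 'v set \<Rightarrow> 'w set \<Rightarrow> ('v \<Rightarrow> 'w) \<Rightarrow> bool"
  where "linear_between s1 s2 V W f \<longleftrightarrow>
    (\<forall>x\<in>V. f x \<in> W) \<and>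
    (\<forall>x\<in>V. \<forall>y\<in>V. f (x + y) = f x + f y) \<and>
    (\<forall>c. \<forall>x\<in>V. f (s1 c x) = s2 c (f x))"

definition linear_iso ::
  "('f::field \<Rightarrow> 'v::ab_group_add \<Rightarrow> 'v) \<Rightarrow> ('f \<Rightarrow> 'w::ab_group_add \<Rightarrow> 'w)
    \<Rightarrow> 'v set \<Rightarrow> 'w set \<Rightarrow> ('v \<Rightarrow> 'w) \<Rightarrow> bool"
  where "linear_iso s1 s2 V W f \<longleftrightarrow> linear_between s1 s2 V W f \<and> bij_betw f V W"

definition fin_dim_space :: "('f::field \<Rightarrow> 'v::ab_group_add \<Rightarrow> 'v) \<Rightarrow> 'v set \<Rightarrow> bool"
  where "fin_dim_space s V \<longleftrightarrow>
    module.subspace s V \<and> (\<exists>B. finite B \<and> V = module.span s B)"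

text \<open>
  \<open>str M i j\<close> is the structure map \<open>M(i \<le> j)\<close>. It is meaningful only for \<open>i \<le> j\<close> and on
  \<open>obj M i\<close>; its values elsewhere are junk and are never consulted.
\<close>

record ('p, 'v) rep =
  obj :: "'p \<Rightarrow> 'v set"
  str :: "'p \<Rightarrow> 'p \<Rightarrow> 'v \<Rightarrow> 'v"

definition persistence_module ::
  "('f::field \<Rightarrow> 'v::ab_group_add \<Rightarrow> 'v) \<Rightarrow> ('p::order, 'v) rep \<Rightarrow> bool"
  where "persistence_module s M \<longleftrightarrow>
    vector_space s \<and>
    (\<forall>i. fin_dim_space s (obj M i)) \<and>
    (\<forall>i j. i \<le> j \<longrightarrow> linear_between s s (obj M i) (obj M j) (str M i j)) \<and>
    (\<forall>i. \<forall>x\<in>obj M i. str M i i x = x) \<and>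
    (\<forall>i j k. i \<le> j \<longrightarrow> j \<le> k \<longrightarrow>
      (\<forall>x\<in>obj M i. str M i k x = str M j k (str M i j x)))"

definition thin :: "('f::field \<Rightarrow> 'v::ab_group_add \<Rightarrow> 'v) \<Rightarrow> ('p, 'v) rep \<Rightarrow> bool"
  where "thin s M \<longleftrightarrow> (\<forall>i. vector_space.dim s (obj M i) \<in> {0, 1})"

text \<open>
  A subrepresentation is given by its values; its structure maps are the restrictions of
  those of \<open>M\<close>.
\<close>

definition subrepresentation ::
  "('f::field \<Rightarrow> 'v::ab_group_add \<Rightarrow> 'v) \<Rightarrow> ('p::order, 'v) rep \<Rightarrow> ('p \<Rightarrow> 'v set) \<Rightarrow> bool"
  where "subrepresentation s M N \<longleftrightarrow>
    (\<forall>i. module.subspace s (N i) \<and> N i \<subseteq> obj M i) \<and>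
    (\<forall>i j. i \<le> j \<longrightarrow> str M i j ` N i \<subseteq> N j)"

definition nonzero_family :: "('p \<Rightarrow> 'v::zero set) \<Rightarrow> bool"
  where "nonzero_family N \<longleftrightarrow> (\<exists>i. N i \<noteq> {0})"

text \<open>
  The direct sum here is the external one, \<open>N i \<times> N' i\<close> with componentwise operations,
  and the isomorphisms for different \<open>i\<close> need not be compatible.
\<close>

definition decomposable ::
  "('f::field \<Rightarrow> 'v::ab_group_add \<Rightarrow> 'v) \<Rightarrow> ('p::order, 'v) rep \<Rightarrow> bool"
  where "decomposable s M \<longleftrightarrow>
    (\<exists>N N'. subrepresentation s M N \<and> subrepresentation s M N' \<and>
      nonzero_family N \<and> nonzero_family N' \<and>
      (\<forall>i. \<exists>f. linear_iso s (module_prod.scale s s) (obj M i) (N i \<times> N' i) f))"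

definition indecomposable ::
  "('f::field \<Rightarrow> 'v::ab_group_add \<Rightarrow> 'v) \<Rightarrow> ('p::order, 'v) rep \<Rightarrow> bool"
  where "indecomposable s M \<longleftrightarrow> \<not> decomposable s M"

definition rep_isomorphic ::
  "('f::field \<Rightarrow> 'v::ab_group_add \<Rightarrow> 'v) \<Rightarrow> ('f \<Rightarrow> 'w::ab_group_add \<Rightarrow> 'w)
    \<Rightarrow> ('p::order, 'v) rep \<Rightarrow> ('p, 'w) rep \<Rightarrow> bool"
  where "rep_isomorphic s1 s2 M N \<longleftrightarrow>
    (\<exists>\<eta>. (\<forall>i. linear_iso s1 s2 (obj M i) (obj N i) (\<eta> i)) \<and>
      (\<forall>i j. i \<le> j \<longrightarrow> (\<forall>x\<in>obj M i. \<eta> j (str M i j x) = str N i j (\<eta> i x))))"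

definition order_convex :: "'p::order set \<Rightarrow> bool"
  where "order_convex I \<longleftrightarrow> (\<forall>i\<in>I. \<forall>k\<in>I. \<forall>j. i \<le> j \<and> j \<le> k \<longrightarrow> j \<in> I)"

definition order_connected :: "'p::order set \<Rightarrow> bool"
  where "order_connected I \<longleftrightarrow>
    (\<forall>a\<in>I. \<forall>b\<in>I. \<exists>(n::nat) x. x 0 = a \<and> x n = b \<and> (\<forall>k\<le>n. x k \<in> I) \<and>
      (\<forall>k<n. x k \<le> x (Suc k) \<or> x (Suc k) \<le> x k))"

definition order_interval :: "'p::order set \<Rightarrow> bool"
  where "order_interval I \<longleftrightarrow> order_connected I \<and> order_convex I"

definition polytope_module :: "'p::order set \<Rightarrow> ('p, 'f::field) rep"
  where "polytope_module I =
    \<lparr> obj = (\<lambda>i. if i \<in> I then UNIV else {0}),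
      str = (\<lambda>i j. if i \<le> j \<and> i \<in> I \<and> j \<in> I then (\<lambda>x. x) else (\<lambda>x. 0)) \<rparr>"

lemma vector_space_self: "vector_space ((*) :: 'f::field \<Rightarrow> 'f \<Rightarrow> 'f)"
  by unfold_locales (simp_all add: algebra_simps)

lemma span_one_self: "module.span ((*) :: 'f::field \<Rightarrow> 'f \<Rightarrow> 'f) {1} = UNIV"
proof -
  interpret vector_space "(*) :: 'f \<Rightarrow> 'f \<Rightarrow> 'f" by (rule vector_space_self)
  show ?thesis by (simp add: span_singleton)
qed

lemma persistence_module_polytope:
  assumes "order_interval I"
  shows "persistence_module (*) (polytope_module I :: ('p::order, 'f::field) rep)"
proof -
  interpret vector_space "(*) :: 'f \<Rightarrow> 'f \<Rightarrow> 'f" by (rule vector_space_self)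
  have 1: "fin_dim_space (*) (UNIV :: 'f set)"
    unfolding fin_dim_space_def
    by (intro conjI subspace_UNIV exI[of _ "{1}"]) (simp_all only: span_one_self finite.intros)
  have 2: "fin_dim_space (*) {0 :: 'f}"
    unfolding fin_dim_space_def
    by (intro conjI subspace_single_0 exI[of _ "{}"]) (simp_all only: span_empty finite.intros)
  have fd: "fin_dim_space (*) (obj (polytope_module I :: ('p, 'f) rep) i)" for i
    using 1 2 by (simp add: polytope_module_def)
  have cvx: "j \<in> I" if "i \<in> I" "k \<in> I" "i \<le> j" "j \<le> k" for i j k
    using assms that unfolding order_interval_def order_convex_def by blast
  have "str (polytope_module I) i k x =
      str (polytope_module I) j k (str (polytope_module I) i j x)"
    if "i \<le> j" "j \<le> k" for i j k and x :: 'f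
    using that cvx[of i k j] order_trans[of i j k] by (simp add: polytope_module_def)
  then show ?thesis
    unfolding persistence_module_def
    using fd vector_space_self
    by (simp add: linear_between_def polytope_module_def)
qed

lemma thin_polytope: "thin (*) (polytope_module I :: ('p::order, 'f::field) rep)"
proof -
  interpret vector_space "(*) :: 'f \<Rightarrow> 'f \<Rightarrow> 'f" by (rule vector_space_self)
  have "dim (UNIV :: 'f set) = 1"
    by (rule dim_unique[of "{1}"]) (simp_all add: span_one_self dependent_single)
  moreover have "dim {0::'f} = 0"
    by (rule dim_unique[of "{}"]) (simp_all add: span_empty independent_empty)
  ultimately show ?thesis by (simp add: thin_def polytope_module_def)
qed

end

theory Submission
  imports Defs
begin

text \<open>
  Let \<open>M\<close> be thin. Consider all pairs \<open>(i, v)\<close> with \<open>0 \<noteq> v \<in> M i\<close>, and join \<open>(i, v)\<close> to \<open>(j, w)\<close>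
  whenever \<open>i \<le> j\<close> and the structure map carries \<open>v\<close> to \<open>w\<close>. A connected component of this graph
  behaves like a covering space of its image \<open>I\<close> in the plane. The aim is to show that it is the
  graph of a function \<open>i \<mapsto> v\<^sub>i\<close> on \<open>I\<close> such that \<open>M (i \<le> j)\<close> sends \<open>v\<^sub>i\<close> to \<open>v\<^sub>j\<close> for all \<open>i \<le> j\<close> in \<open>I\<close>.
  What has to be excluded is monodromy (two vectors over the same point) and a vanishing
  structure map between comparable points of \<open>I\<close>.

  Both are excluded by the order geometry of a product of two chains (\<open>connected_related\<close>):
  two points in one component are either joined by a single edge, or by a staircase that only
  moves to the right and down. This property survives prolonging a walk by one horizontal or
  vertical edge, because an edge between comparable points fills the entire rectangle spanned
  by them, and such rectangles can be swept along a staircase. A staircase between comparable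
  points cannot bend, so comparable points of a component are always joined by a single edge
  (\<open>connected_imp_edge\<close>); in particular, two points in the same fibre coincide.

  Hence \<open>I\<close> is an interval. Moreover, no nonzero structure map joins \<open>I\<close> to its complement
  (\<open>str_eq_0_at_sheet_boundary\<close>), so the restrictions of \<open>M\<close> to \<open>I\<close> and to its complement are
  subrepresentations with direct sum \<open>M\<close>. If \<open>M\<close> is indecomposable and nonzero, then it is
  supported on \<open>I\<close>, and reading off coordinates with respect to \<open>v\<^sub>i\<close> is the isomorphism with
  the polytope module.
\<close>

section \<open>Coverings of a product of two chains\<close>

text \<open>
  The points lie over a product of two chains, with coordinates \<open>X\<close> and \<open>Y\<close>. The axioms say
  that each edge comes with a lift of the whole rectangle spanned by its endpoints, and that
  lifts are unique from either end. The two coordinates are kept separate so that they can be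
  exchanged.
\<close>

locale planar_cover =
  fixes X :: "'e \<Rightarrow> 'a::linorder" and Y :: "'e \<Rightarrow> 'b::linorder"
    and r :: "'e \<Rightarrow> 'e \<Rightarrow> bool"
  assumes mono_X: "r p q \<Longrightarrow> X p \<le> X q"
    and mono_Y: "r p q \<Longrightarrow> Y p \<le> Y q"
    and trans_r: "r p q \<Longrightarrow> r q k \<Longrightarrow> r p k"
    and edge_in_fibre: "r p q \<Longrightarrow> X p = X q \<Longrightarrow> Y p = Y q \<Longrightarrow> p = q"
    and fill: "r p q \<Longrightarrow> X p \<le> a \<Longrightarrow> a \<le> X q \<Longrightarrow> Y p \<le> b \<Longrightarrow> b \<le> Y q \<Longrightarrow>
      \<exists>u. X u = a \<and> Y u = b \<and> r p u \<and> r u q"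
    and unique_source: "r p q \<Longrightarrow> r p' q \<Longrightarrow> X p = X p' \<Longrightarrow> Y p = Y p' \<Longrightarrow> p = p'"
    and unique_target: "r p q \<Longrightarrow> r p q' \<Longrightarrow> X q = X q' \<Longrightarrow> Y q = Y q' \<Longrightarrow> q = q'"
begin

lemma transposed: "planar_cover Y X r"
proof unfold_locales
  show "\<exists>u. Y u = b \<and> X u = a \<and> r p u \<and> r u q"
    if "r p q" "Y p \<le> b" "b \<le> Y q" "X p \<le> a" "a \<le> X q" for p q a b
    using fill[of p q a b] that by blast
qed (auto intro: mono_X mono_Y trans_r edge_in_fibre unique_source unique_target)

lemma cancel_source:
  assumes "r p q" "r u q" "X p \<le> X u" "Y p \<le> Y u"
  shows "r p u"
  using fill[OF assms(1,3) mono_X[OF assms(2)] assms(4) mono_Y[OF assms(2)]]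
    unique_source[OF assms(2)] by metis

lemma cancel_target:
  assumes "r p q" "r p u" "X u \<le> X q" "Y u \<le> Y q"
  shows "r u q"
  using fill[OF assms(1) mono_X[OF assms(2)] assms(3) mono_Y[OF assms(2)] assms(4)]
    unique_target[OF assms(2)] by metis

definition hor :: "'e \<Rightarrow> 'e \<Rightarrow> bool" where
  "hor p q \<longleftrightarrow> r p q \<and> Y p = Y q"

definition ver :: "'e \<Rightarrow> 'e \<Rightarrow> bool" where
  "ver p q \<longleftrightarrow> r p q \<and> X p = X q"

definition staircase :: "'e \<Rightarrow> 'e \<Rightarrow> bool" where
  "staircase = (\<lambda>p q. hor p q \<or> ver q p)\<^sup>*\<^sup>*"

lemma staircase_refl: "staircase p p"
  by (simp add: staircase_def)

lemma staircase_right: "staircase p q \<Longrightarrow> hor q k \<Longrightarrow> staircase p k"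
  unfolding staircase_def by (rule rtranclp.rtrancl_into_rtrancl) auto

lemma staircase_down: "staircase p q \<Longrightarrow> ver k q \<Longrightarrow> staircase p k"
  unfolding staircase_def by (rule rtranclp.rtrancl_into_rtrancl) auto

lemma right_staircase: "hor k p \<Longrightarrow> staircase p q \<Longrightarrow> staircase k q"
  unfolding staircase_def by (rule converse_rtranclp_into_rtranclp) auto

lemma staircase_induct [consumes 1, case_names refl right down]:
  assumes "staircase p q"
    and "P p"
    and "\<And>q k. staircase p q \<Longrightarrow> hor q k \<Longrightarrow> P q \<Longrightarrow> P k"
    and "\<And>q k. staircase p q \<Longrightarrow> ver k q \<Longrightarrow> P q \<Longrightarrow> P k"
  shows "P q"
  using assms(1) unfolding staircase_def
  by (induction rule: rtranclp_induct) (use assms(2-4) staircase_def in auto)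

text \<open>
  Exchanging the coordinates turns right and down into up and left, so it reverses staircases;
  each statement about horizontal edges thereby yields one about vertical edges.
\<close>

lemma staircase_swap: "planar_cover.staircase Y X r p q \<longleftrightarrow> staircase q p"
proof -
  interpret T: planar_cover Y X r by (rule transposed)
  have "(\<lambda>p q. T.hor p q \<or> T.ver q p) = (\<lambda>p q. hor p q \<or> ver q p)\<inverse>\<inverse>"
    by (auto simp: fun_eq_iff T.hor_def T.ver_def hor_def ver_def)
  then show ?thesis
    by (simp add: T.staircase_def staircase_def rtranclp_conversep)
qed

lemma staircase_mono: "staircase p q \<Longrightarrow> X p \<le> X q \<and> Y q \<le> Y p"
  by (induction rule: staircase_induct)
    (auto simp: hor_def ver_def dest: mono_X mono_Y)

text \<open>A staircase that does not descend consists of horizontal steps, which compose.\<close>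

lemma flat_staircase: "staircase p q \<Longrightarrow> Y p \<le> Y q \<Longrightarrow> p = q \<or> r p q"
proof (induction rule: staircase_induct)
  case refl
  then show ?case by simp
next
  case (right q k)
  then show ?case
    by (auto simp: hor_def intro: trans_r)
next
  case (down q k)
  from \<open>staircase p q\<close> have "Y q \<le> Y p" by (simp add: staircase_mono)
  moreover have "Y k \<le> Y q" using down by (simp add: ver_def mono_Y)
  ultimately have "k = q"
    using down edge_in_fibre[of k q] by (auto simp: ver_def)
  with down show ?case by simp
qed

lemma steep_staircase:
  assumes "staircase p q" "X q \<le> X p"
  shows "p = q \<or> r q p"
proof -
  interpret T: planar_cover Y X r by (rule transposed)
  show ?thesis using T.flat_staircase[of q p] assms by (auto simp: staircase_swap)
qed

text \<open>
  Stepping back to the left from the end of a staircase: the horizontal edge is swept upwards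
  along every descent of the staircase, and cut short at every horizontal step, until it
  either falls inside the staircase or has been swept all the way to the start.
\<close>

lemma staircase_left: "staircase p q \<Longrightarrow> hor k q \<Longrightarrow> r k p \<or> staircase p k"
proof (induction arbitrary: k rule: staircase_induct)
  case refl
  then show ?case by (simp add: hor_def)
next
  case (right q' q)
  show ?case
  proof (cases "X q' \<le> X k")
    case True
    then have "hor q' k"
      using right cancel_source[of q' q k] by (auto simp: hor_def)
    with right show ?thesis by (blast intro: staircase_right)
  next
    case False
    then have "hor k q'"
      using right cancel_source[of k q q'] by (auto simp: hor_def)
    with right show ?thesis by blast
  qed
next
  case (down q' q)
  then have *: "r k q" "r q q'" "r k q'" "Y k = Y q" "X q = X q'"
    by (auto simp: hor_def ver_def intro: trans_r)
  obtain u where u: "X u = X k" "Y u = Y q'" "r k u" "r u q'"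
    using fill[OF \<open>r k q'\<close>, of "X k" "Y q'"] mono_X[OF \<open>r k q'\<close>] mono_Y[OF \<open>r k q'\<close>] by auto
  then have "hor u q'" "ver k u" by (auto simp: hor_def ver_def)
  with down.IH[of u] u show ?case by (blast intro: trans_r staircase_down)
qed

text \<open>The same sweep for an upward step; here the horizontal steps move the edge.\<close>

lemma staircase_up: "staircase p q \<Longrightarrow> ver q k \<Longrightarrow> r p k \<or> staircase p k"
proof (induction arbitrary: k rule: staircase_induct)
  case refl
  then show ?case by (simp add: ver_def)
next
  case (right q' q)
  then have *: "r q' q" "r q k" "r q' k" "Y q' = Y q" "X q = X k"
    by (auto simp: hor_def ver_def intro: trans_r)
  obtain u where u: "X u = X q'" "Y u = Y k" "r q' u" "r u k"
    using fill[OF \<open>r q' k\<close>, of "X q'" "Y k"] mono_X[OF \<open>r q' k\<close>] mono_Y[OF \<open>r q' k\<close>] by auto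
  then have "ver q' u" "hor u k" by (auto simp: hor_def ver_def)
  with right.IH[of u] u show ?case by (blast intro: trans_r staircase_right)
next
  case (down q' q)
  show ?case
  proof (cases "Y k \<le> Y q'")
    case True
    then have "ver k q'"
      using down cancel_target[of q q' k] by (auto simp: ver_def)
    with down show ?thesis by (blast intro: staircase_down)
  next
    case False
    then have "ver q' k"
      using down cancel_target[of q k q'] by (auto simp: ver_def)
    with down show ?thesis by blast
  qed
qed

definition related :: "'e \<Rightarrow> 'e \<Rightarrow> bool" where
  "related p q \<longleftrightarrow> r p q \<or> r q p \<or> staircase p q \<or> staircase q p"

lemma related_swap: "planar_cover.related Y X r p q \<longleftrightarrow> related p q"
proof -
  interpret T: planar_cover Y X r by (rule transposed)
  show ?thesis by (auto simp: T.related_def related_def staircase_swap)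
qed

text \<open>
  If an edge is prolonged by one that turns back, either the new endpoint still lies in the
  rectangle spanned by the edge, or the side of that rectangle closes a staircase with one bend.
\<close>

lemma related_right:
  assumes "related p q" "hor q k"
  shows "related p k"
proof -
  interpret T: planar_cover Y X r by (rule transposed)
  have qk: "r q k" "Y q = Y k" using assms(2) by (auto simp: hor_def)
  consider "r p q" | "r q p" | "staircase p q" | "staircase q p"
    using assms(1) by (auto simp: related_def)
  then show ?thesis
  proof cases
    case 1
    then show ?thesis using qk trans_r by (auto simp: related_def)
  next
    case 2
    show ?thesis
    proof (cases "X k \<le> X p")
      case True
      then have "r k p"
        using cancel_target[of q p k] 2 qk mono_Y[OF 2] by auto
      then show ?thesis by (simp add: related_def)
    next
      case False
      obtain u where u: "X u = X p" "Y u = Y q" "r q u" "r u p"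
        using fill[OF 2, of "X p" "Y q"] mono_X[OF 2] mono_Y[OF 2] by auto
      then have "r u k" using cancel_target[of q k u] False qk by auto
      with u qk have "ver u p" "hor u k" by (auto simp: hor_def ver_def)
      then show ?thesis
        using staircase_right[OF staircase_down[OF staircase_refl]] by (auto simp: related_def)
    qed
  next
    case 3
    then show ?thesis using staircase_right assms(2) by (auto simp: related_def)
  next
    case 4
    \<comment> \<open>After exchanging the coordinates, this is an upward step from the end of a staircase.\<close>
    then show ?thesis
      using T.staircase_up[of p q k] qk
      by (auto simp: related_def staircase_swap T.ver_def)
  qed
qed

lemma related_left:
  assumes "related p q" "hor k q"
  shows "related p k"
proof -
  have kq: "r k q" "Y k = Y q" using assms(2) by (auto simp: hor_def)
  consider "r p q" | "r q p" | "staircase p q" | "staircase q p"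
    using assms(1) by (auto simp: related_def)
  then show ?thesis
  proof cases
    case 1
    show ?thesis
    proof (cases "X p \<le> X k")
      case True
      then have "r p k"
        using cancel_source[of p q k] 1 kq mono_Y[OF 1] by auto
      then show ?thesis by (simp add: related_def)
    next
      case False
      obtain u where u: "X u = X p" "Y u = Y q" "r p u" "r u q"
        using fill[OF 1, of "X p" "Y q"] mono_X[OF 1] mono_Y[OF 1] by auto
      then have "r k u" using cancel_source[of k q u] False kq by auto
      with u kq have "ver p u" "hor k u" by (auto simp: hor_def ver_def)
      then show ?thesis
        using staircase_down[OF staircase_right[OF staircase_refl]] by (auto simp: related_def)
    qed
  next
    case 2
    then show ?thesis using kq trans_r by (auto simp: related_def)
  next
    case 3
    then show ?thesis using staircase_left[OF 3 assms(2)] by (auto simp: related_def)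
  next
    case 4
    then show ?thesis using right_staircase[OF assms(2)] by (auto simp: related_def)
  qed
qed

lemma related_vertical:
  assumes "related p q" "ver q k \<or> ver k q"
  shows "related p k"
proof -
  interpret T: planar_cover Y X r by (rule transposed)
  show ?thesis
    using T.related_right[of p q k] T.related_left[of p q k] assms
    by (auto simp: related_swap T.hor_def ver_def)
qed

lemma edge_via_corner:
  assumes "r p q"
  obtains u where "hor p u" "ver u q"
proof -
  obtain u where "X u = X q" "Y u = Y p" "r p u" "r u q"
    using fill[OF assms, of "X q" "Y p"] mono_X[OF assms] mono_Y[OF assms] by auto
  then show ?thesis by (intro that[of u]) (auto simp: hor_def ver_def)
qed

lemma connected_related: "(\<lambda>p q. r p q \<or> r q p)\<^sup>*\<^sup>* p q \<Longrightarrow> related p q"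
proof (induction rule: rtranclp_induct)
  case base
  show ?case by (simp add: related_def staircase_refl)
next
  case (step q k)
  from \<open>r q k \<or> r k q\<close> show ?case
    using step.IH by (meson edge_via_corner related_left related_right related_vertical)
qed

text \<open>
  The identity \<open>p = q\<close> is a separate alternative only because \<open>r\<close> may fail to relate an
  isolated point to itself.
\<close>

lemma connected_imp_edge:
  assumes "(\<lambda>p q. r p q \<or> r q p)\<^sup>*\<^sup>* p q" "X p \<le> X q" "Y p \<le> Y q"
  shows "p = q \<or> r p q"
proof -
  have "p = q" if "r q p"
    using that assms(2,3) mono_X[OF that] mono_Y[OF that] edge_in_fibre[OF that] by auto
  then show ?thesis
    using connected_related[OF assms(1)] flat_staircase[of p q] steep_staircase[of q p] assms(2,3)
    by (auto simp: related_def)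
qed

end

section \<open>Thin persistence modules\<close>

locale thin_persistence_module = vector_space scale
  for scale :: "'f::field \<Rightarrow> 'v::ab_group_add \<Rightarrow> 'v" +
  fixes M :: "('p::order, 'v) rep"
  assumes persistence: "persistence_module scale M"
    and thin: "thin scale M"
begin

lemma subspace_obj: "subspace (obj M i)"
  using persistence by (simp add: persistence_module_def fin_dim_space_def)

lemma linear_str: "i \<le> j \<Longrightarrow> linear_between scale scale (obj M i) (obj M j) (str M i j)"
  using persistence by (simp add: persistence_module_def)

lemma str_obj: "i \<le> j \<Longrightarrow> x \<in> obj M i \<Longrightarrow> str M i j x \<in> obj M j"
  using linear_str unfolding linear_between_def by blast

lemma str_scale: "i \<le> j \<Longrightarrow> x \<in> obj M i \<Longrightarrow> str M i j (scale c x) = scale c (str M i j x)"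
  using linear_str unfolding linear_between_def by blast

lemma str_0: "i \<le> j \<Longrightarrow> str M i j 0 = 0"
  using str_scale[of i j 0 0] subspace_0[OF subspace_obj] by simp

lemma str_id: "x \<in> obj M i \<Longrightarrow> str M i i x = x"
  using persistence unfolding persistence_module_def by blast

lemma str_comp: "i \<le> j \<Longrightarrow> j \<le> k \<Longrightarrow> x \<in> obj M i \<Longrightarrow> str M i k x = str M j k (str M i j x)"
  using persistence unfolding persistence_module_def by blast

lemma obj_multiple:
  assumes v: "v \<in> obj M i" "v \<noteq> 0" and x: "x \<in> obj M i"
  obtains c where "x = scale c v"
proof -
  obtain B where B: "B \<subseteq> obj M i" "independent B" "obj M i \<subseteq> span B" "card B = dim (obj M i)"
    using basis_exists[of "obj M i"] by blast
  have "fin_dim_space scale (obj M i)"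
    using persistence by (simp add: persistence_module_def)
  then obtain F where F: "finite F" "obj M i = span F"
    unfolding fin_dim_space_def by blast
  have "finite B"
    using independent_span_bound[OF F(1) B(2)] B(1) F(2) by simp
  moreover have "card B \<le> 1"
    using thin B(4) by (auto simp: thin_def le_Suc_eq dest: spec[of _ i])
  ultimately consider "B = {}" | b where "B = {b}"
    by (metis One_nat_def card_1_singletonE card_0_eq le_Suc_eq le_zero_eq)
  then show ?thesis
  proof cases
    case 1
    then show ?thesis using B(3) v by auto
  next
    case (2 b)
    with B(3) have "obj M i \<subseteq> range (\<lambda>k. scale k b)"
      by (simp add: span_singleton)
    with v x obtain k m where km: "v = scale k b" "x = scale m b"
      by blast
    with v have "k \<noteq> 0" by auto
    then have "x = scale (m / k) v" by (simp add: km)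
    then show ?thesis by (rule that)
  qed
qed

definition transports :: "'p \<times> 'v \<Rightarrow> 'p \<times> 'v \<Rightarrow> bool" where
  "transports p q \<longleftrightarrow> fst p \<le> fst q \<and> snd p \<in> obj M (fst p) \<and>
    snd q = str M (fst p) (fst q) (snd p) \<and> snd q \<noteq> 0"

lemma transports_obj:
  assumes "transports p q"
  shows "snd p \<in> obj M (fst p)" "snd q \<in> obj M (fst q)" "snd p \<noteq> 0" "snd q \<noteq> 0"
proof -
  from assms have *: "fst p \<le> fst q" "snd p \<in> obj M (fst p)" "snd q = str M (fst p) (fst q) (snd p)"
      "snd q \<noteq> 0"
    unfolding transports_def by blast+
  show "snd p \<in> obj M (fst p)" "snd q \<noteq> 0" by (fact *)+
  show "snd q \<in> obj M (fst q)" using str_obj[OF *(1,2)] *(3) by simp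
  show "snd p \<noteq> 0" using str_0[OF *(1)] *(3,4) by metis
qed

lemma transports_trans:
  assumes "transports p q" "transports q k"
  shows "transports p k"
  using assms str_comp[of "fst p" "fst q" "fst k" "snd p"] order_trans[of "fst p" "fst q" "fst k"]
  unfolding transports_def by metis

lemma transports_fill:
  assumes "transports p q" "fst p \<le> i" "i \<le> fst q"
  shows "\<exists>u. fst u = i \<and> transports p u \<and> transports u q"
proof -
  let ?u = "(i, str M (fst p) i (snd p))"
  have "str M i (fst q) (snd ?u) = snd q"
    using assms str_comp[of "fst p" i "fst q" "snd p"] by (auto simp: transports_def)
  then have "transports p ?u \<and> transports ?u q"
    using assms str_obj[of "fst p" i "snd p"] str_0[of i "fst q"] by (auto simp: transports_def)
  then show ?thesis by (intro exI[of _ ?u]) simp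
qed

text \<open>A linear map that does not vanish on a line is injective on it.\<close>

lemma transports_unique_source:
  assumes "transports p q" "transports p' q" "fst p = fst p'"
  shows "p = p'"
proof -
  obtain c where c: "snd p' = scale c (snd p)"
    using obj_multiple[of "snd p" "fst p" "snd p'"] transports_obj assms by metis
  have "snd q = scale c (snd q)"
    using assms c str_scale[of "fst p" "fst q" "snd p" c] by (auto simp: transports_def)
  then have "c = 1"
    using transports_obj(4)[OF assms(1)] scale_right_imp_eq[of "snd q" 1 c] by simp
  then show ?thesis using c assms(3) by (simp add: prod_eq_iff)
qed

definition connected_points :: "'p \<times> 'v \<Rightarrow> 'p \<times> 'v \<Rightarrow> bool" where
  "connected_points = (\<lambda>p q. transports p q \<or> transports q p)\<^sup>*\<^sup>*"

lemma connected_points_step: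
  "connected_points p q \<Longrightarrow> transports q k \<or> transports k q \<Longrightarrow> connected_points p k"
  unfolding connected_points_def by (rule rtranclp.rtrancl_into_rtrancl)

lemma connected_points_sym: "connected_points p q \<Longrightarrow> connected_points q p"
  unfolding connected_points_def
  by (rule sympD[OF symp_rtranclp]) (auto intro!: sympI)

lemma connected_points_trans:
  "connected_points p q \<Longrightarrow> connected_points q k \<Longrightarrow> connected_points p k"
  unfolding connected_points_def by (rule rtranclp_trans)

lemma connected_points_obj:
  assumes "connected_points p q" "snd p \<in> obj M (fst p)" "snd p \<noteq> 0"
  shows "snd q \<in> obj M (fst q)" "snd q \<noteq> 0"
  using assms unfolding connected_points_def
  by (induction rule: rtranclp_induct) (auto dest: transports_obj)

definition sheet :: "'p \<times> 'v \<Rightarrow> 'p set" where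
  "sheet p = fst ` {q. connected_points p q}"

lemma sheetI: "connected_points p q \<Longrightarrow> fst q \<in> sheet p"
  by (simp add: sheet_def)

lemma sheetE:
  assumes "i \<in> sheet p"
  obtains v where "connected_points p (i, v)"
  using assms by (auto simp: sheet_def)

lemma order_connected_sheet: "order_connected (sheet p)"
  unfolding order_connected_def
proof (intro ballI)
  fix a b assume a: "a \<in> sheet p" and b: "b \<in> sheet p"
  let ?S = "\<lambda>i j. i \<in> sheet p \<and> j \<in> sheet p \<and> (i \<le> j \<or> j \<le> i)"
  obtain v where v: "connected_points p (a, v)" using a by (rule sheetE)
  obtain w where w: "connected_points p (b, w)" using b by (rule sheetE)
  have walk: "connected_points (a, v) q \<Longrightarrow> ?S\<^sup>*\<^sup>* a (fst q)" for q
    unfolding connected_points_def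
  proof (induction rule: rtranclp_induct)
    case base
    then show ?case by simp
  next
    case (step q k)
    then have "connected_points p q" "connected_points p k"
      using v connected_points_trans connected_points_step
      unfolding connected_points_def by blast+
    then have "?S (fst q) (fst k)"
      using step(2) by (auto simp: transports_def intro: sheetI)
    with step.IH show ?case by (rule rtranclp.rtrancl_into_rtrancl)
  qed
  have "?S\<^sup>*\<^sup>* a b"
    using walk[OF connected_points_trans[OF connected_points_sym[OF v] w]] by simp
  then obtain n where "(?S ^^ n) a b"
    unfolding rtranclp_power ..
  then obtain x where x: "x 0 = a" "x n = b" "\<forall>k<n. ?S (x k) (x (Suc k))"
    unfolding relpowp_fun_conv by blast
  have "x k \<in> sheet p" if "k \<le> n" for k
    using that x a by (cases k) auto
  with x show "\<exists>(n::nat) x. x 0 = a \<and> x n = b \<and> (\<forall>k\<le>n. x k \<in> sheet p) \<and>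
      (\<forall>k<n. x k \<le> x (Suc k) \<or> x (Suc k) \<le> x k)"
    by blast
qed

text \<open>
  This is where thinness makes a sheet split off: a vector in the domain or in the image of a
  nonvanishing structure map is, up to rescaling, the one through which the sheet passes, so
  the map is an edge and the sheet contains both its ends.
\<close>

lemma str_eq_0_at_sheet_boundary:
  assumes p: "snd p \<in> obj M (fst p)" "snd p \<noteq> 0"
    and ij: "i \<le> j" "i \<in> sheet p \<longleftrightarrow> j \<notin> sheet p" and x: "x \<in> obj M i"
  shows "str M i j x = 0"
proof (rule ccontr)
  assume nz: "str M i j x \<noteq> 0"
  then have x0: "x \<noteq> 0" using str_0 ij by auto
  show False
  proof (cases "i \<in> sheet p")
    case True
    then obtain v where v: "connected_points p (i, v)" by (rule sheetE)
    from connected_points_obj[OF v p] have vo: "v \<in> obj M i" "v \<noteq> 0" by auto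
    obtain c where c: "x = scale c v" using obj_multiple[OF vo x] .
    then have "str M i j v \<noteq> 0" using nz str_scale[OF ij(1) vo(1), of c] by auto
    then have "transports (i, v) (j, str M i j v)" using ij vo by (simp add: transports_def)
    then have "j \<in> sheet p" using sheetI[OF connected_points_step[OF v]] by fastforce
    with True ij show False by simp
  next
    case False
    with ij have "j \<in> sheet p" by simp
    then obtain w where w: "connected_points p (j, w)" by (rule sheetE)
    from connected_points_obj[OF w p] have wo: "w \<in> obj M j" "w \<noteq> 0" by auto
    obtain c where c: "w = scale c (str M i j x)"
      using obj_multiple[OF str_obj[OF ij(1) x] nz wo(1)] .
    have "transports (i, scale c x) (j, w)"
      using ij x wo c str_scale[OF ij(1) x] subspace_scale[OF subspace_obj x]
      by (simp add: transports_def)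
    then have "i \<in> sheet p" using sheetI[OF connected_points_step[OF w]] by fastforce
    with False show False by simp
  qed
qed

lemma indecomposable_support:
  assumes p: "snd p \<in> obj M (fst p)" "snd p \<noteq> 0"
    and indec: "indecomposable scale M" and i: "i \<notin> sheet p"
  shows "obj M i = {0}"
proof (rule ccontr)
  assume nz: "obj M i \<noteq> {0}"
  define N where "N i = (if i \<in> sheet p then obj M i else {0})" for i
  define N' where "N' i = (if i \<in> sheet p then {0} else obj M i)" for i
  have 0: "0 \<in> obj M i" for i using subspace_0[OF subspace_obj] .
  have vanish: "str M i j x = 0" if "i \<le> j" "i \<in> sheet p \<longleftrightarrow> j \<notin> sheet p" "x \<in> obj M i" for i j x
    using str_eq_0_at_sheet_boundary[OF p that] .
  have N: "subrepresentation scale M N" "subrepresentation scale M N'"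
    using 0 subspace_obj subspace_single_0 vanish str_obj str_0
    by (auto simp: subrepresentation_def N_def N'_def)
  have "fst p \<in> sheet p" by (rule sheetI) (simp add: connected_points_def)
  then have "N (fst p) \<noteq> {0}" using p by (auto simp: N_def)
  moreover have "N' i \<noteq> {0}" using i nz by (simp add: N'_def)
  ultimately have nonzero: "nonzero_family N" "nonzero_family N'"
    by (auto simp: nonzero_family_def)
  interpret P: module_prod scale scale ..
  have "\<exists>f. linear_iso scale (module_prod.scale scale scale) (obj M i) (N i \<times> N' i) f" for i
  proof (cases "i \<in> sheet p")
    case True
    then have "linear_iso scale (module_prod.scale scale scale) (obj M i) (N i \<times> N' i) (\<lambda>x. (x, 0))"
      by (auto simp: linear_iso_def linear_between_def bij_betw_def inj_on_def N_def N'_def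
          P.scale_def)
    then show ?thesis by blast
  next
    case False
    then have "linear_iso scale (module_prod.scale scale scale) (obj M i) (N i \<times> N' i) (\<lambda>x. (0, x))"
      by (auto simp: linear_iso_def linear_between_def bij_betw_def inj_on_def N_def N'_def
          P.scale_def)
    then show ?thesis by blast
  qed
  with N nonzero have "decomposable scale M"
    unfolding decomposable_def by blast
  with indec show False by (simp add: indecomposable_def)
qed

text \<open>
  A compatible choice of basis vectors on a set that carries all of \<open>M\<close> trivialises \<open>M\<close>; the
  isomorphism sends a vector to its coordinate.
\<close>

lemma iso_polytope_if_section:
  assumes off: "\<And>i. i \<notin> I \<Longrightarrow> obj M i = {0}"
    and b: "\<And>i. i \<in> I \<Longrightarrow> b i \<in> obj M i" "\<And>i. i \<in> I \<Longrightarrow> b i \<noteq> 0"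
    and str_b: "\<And>i j. i \<in> I \<Longrightarrow> j \<in> I \<Longrightarrow> i \<le> j \<Longrightarrow> str M i j (b i) = b j"
  shows "rep_isomorphic scale ((*) :: 'f \<Rightarrow> 'f \<Rightarrow> 'f) M (polytope_module I)"
proof -
  define h where "h i x = (if i \<in> I then (THE c. x = scale c (b i)) else 0)" for i x
  have h_scale: "h i (scale c (b i)) = c" if "i \<in> I" for i c
    using b(2)[OF that] that by (auto simp: h_def)
  have scale_h: "scale (h i x) (b i) = x" if "i \<in> I" "x \<in> obj M i" for i x
    using obj_multiple[OF b[OF that(1)] that(2)] h_scale[OF that(1)] by metis
  have h_off: "h i x = 0" if "i \<notin> I" for i x
    using that by (simp add: h_def)
  have h_zero: "h i 0 = 0" for i
    using h_scale[of i 0] h_off by (cases "i \<in> I") auto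
  have "linear_iso scale (*) (obj M i) (obj (polytope_module I) i) (h i)" for i
  proof (cases "i \<in> I")
    case True
    have "h i (x + y) = h i x + h i y" if "x \<in> obj M i" "y \<in> obj M i" for x y
      using h_scale[OF True, of "h i x + h i y"] scale_h[OF True] that
      by (simp add: scale_left_distrib)
    moreover have "h i (scale c x) = c * h i x" if "x \<in> obj M i" for c x
      using h_scale[OF True, of "c * h i x"] scale_h[OF True that]
      by (simp flip: scale_scale)
    moreover have "bij_betw (h i) (obj M i) UNIV"
      by (rule bij_betw_byWitness[of _ "\<lambda>c. scale c (b i)"])
        (use True h_scale scale_h b subspace_scale[OF subspace_obj] in auto)
    ultimately show ?thesis
      using True by (simp add: linear_iso_def linear_between_def polytope_module_def)
  next
    case False
    then show ?thesis
      using off by (simp add: linear_iso_def linear_between_def polytope_module_def h_off bij_betw_def)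
  qed
  moreover have "h j (str M i j x) = str (polytope_module I) i j (h i x)"
    if ij: "i \<le> j" and x: "x \<in> obj M i" for i j x
  proof (cases "i \<in> I \<and> j \<in> I")
    case True
    then have "str M i j x = scale (h i x) (b j)"
      using scale_h[of i x] str_scale[OF ij, of "b i" "h i x"] x str_b[of i j] b ij by simp
    with True ij h_scale show ?thesis by (simp add: polytope_module_def)
  next
    case False
    then have "h j (str M i j x) = 0"
      using off[of i] x str_0[OF ij] by (auto simp: h_off h_zero)
    with False show ?thesis by (auto simp: polytope_module_def)
  qed
  ultimately show ?thesis unfolding rep_isomorphic_def by blast
qed

end

section \<open>Thin modules over a product of two chains\<close>

theorem thin_indecomposable_iso_polytope:
  fixes M :: "('a::linorder \<times> 'b::linorder, 'v::ab_group_add) rep"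
    and scale :: "'f::field \<Rightarrow> 'v \<Rightarrow> 'v"
  assumes "persistence_module scale M" and "thin scale M" and "indecomposable scale M"
  shows "\<exists>I. order_interval I \<and>
    rep_isomorphic scale ((*) :: 'f \<Rightarrow> 'f \<Rightarrow> 'f) M (polytope_module I)"
proof -
  have "vector_space scale" using assms(1) by (simp add: persistence_module_def)
  then interpret thin_persistence_module scale M
    using assms by (simp add: thin_persistence_module_def thin_persistence_module_axioms_def)
  interpret C: planar_cover "fst \<circ> fst" "snd \<circ> fst" transports
  proof unfold_locales
    fix p q :: "('a \<times> 'b) \<times> 'v" and a b
    assume "transports p q" "(fst \<circ> fst) p \<le> a" "a \<le> (fst \<circ> fst) q"
      "(snd \<circ> fst) p \<le> b" "b \<le> (snd \<circ> fst) q"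
    then show "\<exists>u. (fst \<circ> fst) u = a \<and> (snd \<circ> fst) u = b \<and> transports p u \<and> transports u q"
      using transports_fill[of p q "(a, b)"] by (fastforce simp: less_eq_prod_def)
  next
    fix p q assume "transports p q" "(fst \<circ> fst) p = (fst \<circ> fst) q" "(snd \<circ> fst) p = (snd \<circ> fst) q"
    then show "p = q"
      using str_id[of "snd p" "fst p"] unfolding transports_def comp_def by (metis prod_eqI)
  next
    fix p q k assume "transports p q" "transports q k"
    then show "transports p k" by (rule transports_trans)
  next
    fix p q p' assume "transports p q" "transports p' q"
      "(fst \<circ> fst) p = (fst \<circ> fst) p'" "(snd \<circ> fst) p = (snd \<circ> fst) p'"
    then show "p = p'"
      using transports_unique_source[of p q p'] by (simp add: prod_eq_iff[of "fst p"])
  qed (auto simp: transports_def less_eq_prod_def prod_eq_iff)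
  show ?thesis
  proof (cases "\<forall>i. obj M i = {0}")
    case True
    have "order_interval ({} :: ('a \<times> 'b) set)"
      by (simp add: order_interval_def order_connected_def order_convex_def)
    then show ?thesis using iso_polytope_if_section[of "{}"] True by auto
  next
    case False
    then obtain i\<^sub>0 v\<^sub>0 where v0: "v\<^sub>0 \<in> obj M i\<^sub>0" "v\<^sub>0 \<noteq> 0"
      using subspace_0[OF subspace_obj] by blast
    let ?p = "(i\<^sub>0, v\<^sub>0)"
    define b where "b i = (SOME v. connected_points ?p (i, v))" for i
    have b: "connected_points ?p (i, b i)" if "i \<in> sheet ?p" for i
      using that unfolding b_def by (meson sheetE someI)
    have bo: "b i \<in> obj M i" "b i \<noteq> 0" if "i \<in> sheet ?p" for i
      using connected_points_obj[OF b[OF that]] v0 by auto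
    have edge: "transports (i, b i) (j, b j)"
      if ij: "i \<in> sheet ?p" "j \<in> sheet ?p" "i \<le> j" for i j
    proof -
      have "connected_points (i, b i) (j, b j)"
        using b[OF ij(1)] b[OF ij(2)] connected_points_sym connected_points_trans by blast
      then have "(i, b i) = (j, b j) \<or> transports (i, b i) (j, b j)"
        using C.connected_imp_edge[of "(i, b i)" "(j, b j)"] ij(3)
        by (simp add: connected_points_def less_eq_prod_def)
      moreover have "transports (i, b i) (i, b i)"
        using bo[OF ij(1)] by (simp add: transports_def str_id)
      ultimately show ?thesis by auto
    qed
    have "order_convex (sheet ?p)"
      unfolding order_convex_def
    proof (intro ballI allI impI)
      fix i k j assume ik: "i \<in> sheet ?p" "k \<in> sheet ?p" and j: "i \<le> j \<and> j \<le> k"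
      then have "transports (i, b i) (k, b k)" by (intro edge) (auto intro: order_trans)
      then obtain u where "fst u = j" "transports (i, b i) u"
        using transports_fill[of "(i, b i)" "(k, b k)" j] j unfolding fst_conv by blast
      then show "j \<in> sheet ?p"
        using sheetI[OF connected_points_step[OF b[OF ik(1)]]] by blast
    qed
    then have "order_interval (sheet ?p)"
      by (simp add: order_interval_def order_connected_sheet)
    moreover have "rep_isomorphic scale ((*) :: 'f \<Rightarrow> 'f \<Rightarrow> 'f) M (polytope_module (sheet ?p))"
    proof (rule iso_polytope_if_section)
      show "obj M i = {0}" if "i \<notin> sheet ?p" for i
        using indecomposable_support[of ?p i] v0 assms(3) that by simp
      show "str M i j (b i) = b j" if "i \<in> sheet ?p" "j \<in> sheet ?p" "i \<le> j" for i j
        using edge[OF that] by (simp add: transports_def)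
    qed (use bo in auto)
    ultimately show ?thesis by blast
  qed
qed

theorem theorem3:
  fixes scale :: "'f::field \<Rightarrow> 'v::ab_group_add \<Rightarrow> 'v"
    and M :: "(real \<times> real, 'v) rep"
  assumes "persistence_module scale M"
    and "thin scale M"
    and "indecomposable scale M"
  shows "\<exists>I :: (real \<times> real) set. order_interval I \<and>
    rep_isomorphic scale ((*) :: 'f \<Rightarrow> 'f \<Rightarrow> 'f) M (polytope_module I)"
  using assms by (rule thin_indecomposable_iso_polytope)

end
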